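(* There exists a family of $n$-node directed graphs $G$ with diameter $O(\log n)$ such that any reachability-preserving DAG cover of $G$ with no additional edges requires $n$ DAGs.
   Context: A DAG cover of a directed graph $G$ with no additional edges is a collection $D_1,\dots,D_g$ of directed acyclic graphs with vertex set $V(G)$ and $E(D_i)\subseteq E(G)$ for all $i$. It is reachability-preserving if for all $s,t\in V(G)$: $s$ can reach $t$ in $G$ if and only if there exists $i$ such that $s$ can reach $t$ in $D_i$. The diameter of $G$ is the maximum over ordered pairs $(s,t)$ with $s$ reaching $t$ of the (unweighted) shortest path length from $s$ to $t$. *)

theory Defs
  imports
    Complex_Main
    "HOL-Library.Landau_Symbols"
    "Graph_Theory.Graph_Theory"
begin

text \<open>
  Directed graphs, walks, reachability, cycles and spanning subgraphs are those of
  the AFP entry Graph_Theory. There, reachability is reflexive on the vertex set, and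
  a cycle is a closed directed walk of positive length whose vertices are distinct
  (so a loop is a cycle).
\<close>

definition dag :: "('a, 'b) pre_digraph \<Rightarrow> bool" where
  "dag D \<longleftrightarrow> fin_digraph D \<and> (\<nexists>p. pre_digraph.cycle D p)"

text \<open>
  The value is meaningful only if \<open>t\<close> is reachable from \<open>s\<close>; otherwise the set below
  is empty.
\<close>

definition distance :: "('a, 'b) pre_digraph \<Rightarrow> 'a \<Rightarrow> 'a \<Rightarrow> nat" where
  "distance G s t = Inf {length p | p. pre_digraph.awalk G s p t}"

text \<open>
  For a finite graph with at least one vertex the maximum ranges over a finite nonempty
  set: reachability implies membership of both endpoints in the vertex set.
\<close>

definition diameter :: "('a, 'b) pre_digraph \<Rightarrow> nat" where
  "diameter G = Max {distance G s t | s t. s \<rightarrow>\<^sup>*\<^bsub>G\<^esub> t}"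

text \<open>
  A collection of DAGs is a list, so that its size is the length of the list.
  No additional edges: every member is a subgraph on all the vertices of \<open>G\<close>.
\<close>

definition dag_cover_no_additional_edges ::
  "('a, 'b) pre_digraph \<Rightarrow> ('a, 'b) pre_digraph list \<Rightarrow> bool" where
  "dag_cover_no_additional_edges G Ds \<longleftrightarrow> (\<forall>D \<in> set Ds. dag D \<and> spanning D G)"

definition reachability_preserving ::
  "('a, 'b) pre_digraph \<Rightarrow> ('a, 'b) pre_digraph list \<Rightarrow> bool" where
  "reachability_preserving G Ds \<longleftrightarrow>
     (\<forall>s \<in> verts G. \<forall>t \<in> verts G.
        s \<rightarrow>\<^sup>*\<^bsub>G\<^esub> t \<longleftrightarrow> (\<exists>D \<in> set Ds. s \<rightarrow>\<^sup>*\<^bsub>D\<^esub> t))"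

text \<open>Agreement with the library's weighted distance for unit weights.\<close>

lemma (in wf_digraph) mu_unit_weights_eq_distance:
  assumes "s \<rightarrow>\<^sup>* t"
  shows "\<mu> (\<lambda>_. 1) s t = ereal (real (distance G s t))"
proof -
  let ?L = "{length p | p. awalk s p t}"
  have cost: "awalk_cost (\<lambda>_. 1) p = real (length p)" for p :: "'b awalk"
    by (induction p) auto
  have ne: "?L \<noteq> {}" using assms by (auto simp: reachable_awalk)
  from Inf_nat_def1[OF ne] obtain p where p: "awalk s p t" "length p = distance G s t"
    unfolding distance_def by auto
  have "distance G s t \<le> length q" if "awalk s q t" for q
    unfolding distance_def using that by (intro cInf_lower) auto
  with p show ?thesis
    unfolding \<mu>_def cost by (intro antisym INF_greatest INF_lower2[of p]) auto
qed

end

theory Submission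
  imports Defs
begin

text \<open>
  Let the vertices be $0, \dots, n-1$, with the arcs $a \to a + 2^k$ for $2^k \mid a$ and one
  back arc $n-1 \to 0$. Climbing and descending the dyadic scales gives the logarithmic diameter.
  The dyadic intervals form a laminar family, so the forward arcs, drawn as chords, do not cross.

  The $n$ hard pairs are $(j, j-1)$, indices modulo $n$. If $i < j$, a DAG serving both
  $(i, i-1)$ and $(j, j-1)$ contains the back arc, a forward walk from $i$ to $n-1$ and one from $0$
  to $j-1$. As $0 \le i \le j-1 \le n-1$, planarity forces these two walks to meet, hence $0$ reaches
  $n-1$, which closes a cycle with the back arc. So the hard pairs need pairwise distinct DAGs.
\<close>

section \<open>Noncrossing relations\<close>

text \<open>For increasing pairs the second clause says that the open intervals are pairwise nested
  or disjoint. Common endpoints are allowed.\<close>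

definition noncrossing :: "(nat \<times> nat) set \<Rightarrow> bool" where
  "noncrossing U \<longleftrightarrow> (\<forall>(a, b) \<in> U. a < b) \<and>
     (\<forall>a b c d. (a, b) \<in> U \<longrightarrow> (c, d) \<in> U \<longrightarrow> a < c \<longrightarrow> c < b \<longrightarrow> d \<le> b)"

lemma noncrossing_subset: "noncrossing V \<Longrightarrow> U \<subseteq> V \<Longrightarrow> noncrossing U"
  unfolding noncrossing_def by blast

lemma noncrossing_rtrancl_le:
  assumes "noncrossing U" "(a, b) \<in> U\<^sup>*"
  shows "a \<le> b"
  using assms(2) by induction (use assms(1) in \<open>auto simp: noncrossing_def\<close>)

text \<open>The walk from \<open>a\<close> to \<open>m\<close> either visits \<open>i\<close> or
  jumps over it by an arc landing at some \<open>b\<close> \<le> \<open>m\<close>. In the latter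
  case the walk from \<open>i\<close> starts under that arc and cannot leap past \<open>b\<close>,
  yet it ends at \<open>k\<close> \<ge> \<open>b\<close>. So it visits \<open>b\<close>, where the
  two walks are spliced.\<close>

lemma noncrossing_rtrancl_meet:
  assumes U: "noncrossing U"
    and am: "(a, m) \<in> U\<^sup>*" and ik: "(i, k) \<in> U\<^sup>*" and "a \<le> i" "i \<le> m" "m \<le> k"
  shows "(a, k) \<in> U\<^sup>*"
proof -
  have inc: "x < y" if "(x, y) \<in> U" for x y
    using U that by (auto simp: noncrossing_def)
  \<comment> \<open>The witness is the first vertex of the walk that is at least
    \<open>i\<close>.\<close>
  have "\<exists>b. (a, b) \<in> U\<^sup>* \<and> i \<le> b \<and> b \<le> m \<and> (b = i \<or> (\<exists>a'. (a', b) \<in> U \<and> a' < i))"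
    using am \<open>a \<le> i\<close> \<open>i \<le> m\<close>
  proof induction
    case base
    then show ?case by auto
  next
    case (step y z)
    show ?case
    proof (cases "i \<le> y")
      case True
      with step inc[OF step(2)] show ?thesis by (meson order_trans less_imp_le)
    next
      case False
      with step show ?thesis
        by (meson not_le order_refl rtrancl.rtrancl_into_rtrancl)
    qed
  qed
  then obtain b where b: "(a, b) \<in> U\<^sup>*" "i \<le> b" "b \<le> m" and
    enter: "b = i \<or> (\<exists>a'. (a', b) \<in> U \<and> a' < i)" by blast
  have "(b, k) \<in> U\<^sup>*"
  proof (cases "b = i")
    case True
    with ik show ?thesis by simp
  next
    case False
    with enter obtain a' where a': "(a', b) \<in> U" "a' < i" by blast
    from ik a'(2) \<open>i \<le> b\<close> show ?thesis
    proof (induction rule: converse_rtrancl_induct)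
      case base
      with \<open>b \<le> m\<close> \<open>m \<le> k\<close> have "b = k" by linarith
      then show ?case by simp
    next
      case (step y z)
      show ?case
      proof (cases "y = b")
        case True
        with step show ?thesis by (meson converse_rtrancl_into_rtrancl)
      next
        case False
        with step.prems have "y < b" by simp
        with U a'(1) step(1) step.prems have "z \<le> b"
          unfolding noncrossing_def by blast
        with step inc[OF step(1)] show ?thesis by simp
      qed
    qed
  qed
  with b(1) show ?thesis by (rule rtrancl_trans)
qed

text \<open>Whatever lies between the first and the last use of the back arc can be cut out, so one
  use suffices.\<close>

lemma rtrancl_insert_back_arc:
  assumes "(u, v) \<in> R\<^sup>*" "R \<subseteq> insert (N, 0) U"
  shows "(u, v) \<in> (R \<inter> U)\<^sup>* \<or>
    (u, N) \<in> (R \<inter> U)\<^sup>* \<and> (N, 0) \<in> R \<and> (0, v) \<in> (R \<inter> U)\<^sup>*"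
  using assms(1)
proof induction
  case base
  then show ?case by simp
next
  case (step y z)
  show ?case
  proof (cases "(y, z) \<in> U")
    case True
    with step.hyps(2) have "(y, z) \<in> R \<inter> U" by simp
    with step.IH show ?thesis by (meson rtrancl.rtrancl_into_rtrancl)
  next
    case False
    with step.hyps(2) assms(2) have "y = N" "z = 0" by auto
    with step show ?thesis by auto
  qed
qed

definition cyclic_pred :: "nat \<Rightarrow> nat \<Rightarrow> nat" where
  "cyclic_pred N i = (if i = 0 then N else i - 1)"

lemma cyclic_pred_pairs_conflict:
  assumes U: "noncrossing U" and R: "R \<subseteq> insert (N, 0) U" and "i < j" "j \<le> N"
    and i: "(i, cyclic_pred N i) \<in> R\<^sup>*" and j: "(j, cyclic_pred N j) \<in> R\<^sup>*"
  shows "\<not> acyclic R"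
proof -
  have V: "noncrossing (R \<inter> U)" using U by (rule noncrossing_subset) simp
  \<comment> \<open>Forward arcs only increase, so a walk to a smaller vertex must take the back
    arc.\<close>
  have wrap: "(u, N) \<in> (R \<inter> U)\<^sup>* \<and> (N, 0) \<in> R \<and> (0, v) \<in> (R \<inter> U)\<^sup>*"
    if "(u, v) \<in> R\<^sup>*" "v < u" for u v
    using rtrancl_insert_back_arc[OF that(1) R] noncrossing_rtrancl_le[OF V, of u v] that(2)
    by auto
  have jb: "(N, 0) \<in> R" "(0, j - 1) \<in> (R \<inter> U)\<^sup>*"
    using wrap[OF j] \<open>i < j\<close> by (auto simp: cyclic_pred_def)
  have "(0, N) \<in> R\<^sup>*"
  proof (cases "i = 0")
    case True
    with i show ?thesis by (simp add: cyclic_pred_def)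
  next
    case False
    then have "(i, N) \<in> (R \<inter> U)\<^sup>*"
      using wrap[OF i] by (auto simp: cyclic_pred_def)
    \<comment> \<open>The walks from 0 to \<open>j - 1\<close> and from \<open>i\<close> to
      \<open>N\<close> meet, since 0 \<le> \<open>i\<close> \<le> \<open>j - 1\<close> \<le>
      \<open>N\<close>.\<close>
    then have "(0, N) \<in> (R \<inter> U)\<^sup>*"
      using noncrossing_rtrancl_meet[OF V jb(2)] \<open>i < j\<close> \<open>j \<le> N\<close> by simp
    then show ?thesis by (rule rtrancl_mono[THEN subsetD, rotated]) simp
  qed
  from this jb(1) have "(0, 0) \<in> R\<^sup>+" by (rule rtrancl_into_trancl1)
  then show ?thesis by (auto simp: acyclic_def)
qed

section \<open>The dyadic graph\<close>

definition dyadic_steps :: "nat \<Rightarrow> (nat \<times> nat) set" where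
  "dyadic_steps n = {(a, a + 2 ^ k) | a k. 2 ^ k dvd a \<and> a + 2 ^ k < n}"

text \<open>The guard \<open>2 \<le> n\<close> matters because \<open>digraph\<close> forbids loops:
  for \<open>n = 1\<close> the back arc would be one.\<close>

definition dyadic_digraph :: "nat \<Rightarrow> (nat, nat \<times> nat) pre_digraph" where
  "dyadic_digraph n = \<lparr>verts = {..<n},
     arcs = dyadic_steps n \<union> (if 2 \<le> n then {(n - 1, 0)} else {}), tail = fst, head = snd\<rparr>"

text \<open>If \<open>c\<close> lies strictly between \<open>a\<close> and \<open>a + 2 ^ k\<close>,
  it is no multiple of \<open>2 ^ k\<close>, so its step length \<open>2 ^ l\<close> is a smaller
  power. Then \<open>b\<close> is a multiple of \<open>2 ^ l\<close> beyond \<open>c\<close>, hence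
  at least \<open>c + 2 ^ l\<close>.\<close>

lemma noncrossing_dyadic_steps: "noncrossing (dyadic_steps n)"
  unfolding noncrossing_def
proof (intro conjI allI impI)
  show "\<forall>(a, b) \<in> dyadic_steps n. a < b" by (auto simp: dyadic_steps_def)
next
  fix a b c d
  assume "(a, b) \<in> dyadic_steps n" "(c, d) \<in> dyadic_steps n" and ac: "a < c" and cb: "c < b"
  then obtain k l where k: "2 ^ k dvd a" "b = a + 2 ^ k" and l: "2 ^ l dvd c" "d = c + 2 ^ l"
    by (auto simp: dyadic_steps_def)
  have "l < k"
  proof (rule ccontr)
    assume "\<not> l < k"
    then have "2 ^ k dvd c" using l(1) by (meson le_imp_power_dvd dvd_trans not_less)
    then have "2 ^ k dvd c - a" using k(1) by (rule dvd_diff_nat)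
    then have "2 ^ k \<le> c - a" using ac by (intro dvd_imp_le) auto
    with ac cb k(2) show False by linarith
  qed
  then have "(2::nat) ^ l dvd 2 ^ k" by (simp add: le_imp_power_dvd)
  then have "2 ^ l dvd b" using k by (meson dvd_add dvd_trans)
  then have "2 ^ l dvd b - c" using l(1) by (rule dvd_diff_nat)
  then have "2 ^ l \<le> b - c" using cb by (intro dvd_imp_le) auto
  with cb l(2) show "d \<le> b" by linarith
qed

lemma card_verts_dyadic: "card (verts (dyadic_digraph n)) = n"
  by (simp add: dyadic_digraph_def)

lemma digraph_dyadic: "digraph (dyadic_digraph n)"
proof -
  have "arcs (dyadic_digraph n) \<subseteq> {..<n} \<times> {..<n}"
    by (auto simp: dyadic_digraph_def dyadic_steps_def)
  then have "finite (arcs (dyadic_digraph n))" by (rule finite_subset) simp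
  then show ?thesis
    by unfold_locales
      (auto simp: dyadic_digraph_def dyadic_steps_def arc_to_ends_def split: if_splits)
qed

lemma dyadic_cover_conflict:
  assumes "dag D" "spanning D (dyadic_digraph n)" "i < j" "j < n"
    and "i \<rightarrow>\<^sup>*\<^bsub>D\<^esub> cyclic_pred (n - 1) i" "j \<rightarrow>\<^sup>*\<^bsub>D\<^esub> cyclic_pred (n - 1) j"
  shows False
proof -
  interpret fin_digraph D using assms(1) by (simp add: dag_def)
  have "arcs_ends D \<subseteq> insert (n - 1, 0) (dyadic_steps n)"
    using assms(2)
    by (auto simp: spanning_def subgraph_def compatible_def arcs_ends_def arc_to_ends_def
        dyadic_digraph_def split: if_splits)
  then have "\<not> acyclic (arcs_ends D)"
    using assms(3-6) by (intro cyclic_pred_pairs_conflict[OF noncrossing_dyadic_steps, of _ "n - 1" n i j])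
      (auto simp: reachable_conv)
  \<comment> \<open>A cycle of the relation is only a closed walk; a cycle with distinct vertices is
    extracted from it.\<close>
  then obtain u p where "awalk u p u" "p \<noteq> []"
    by (auto simp: acyclic_def reachable1_awalk)
  then have "\<exists>p. cycle p" by (intro closed_w_imp_cycle) (auto simp: closed_w_def)
  with assms(1) show False by (simp add: dag_def)
qed

section \<open>Distances\<close>

text \<open>Unlike an upper bound on \<open>distance\<close>, this also certifies
  reachability.\<close>

definition walk_within :: "('a, 'b) pre_digraph \<Rightarrow> 'a \<Rightarrow> 'a \<Rightarrow> nat \<Rightarrow> bool" where
  "walk_within G u v l \<longleftrightarrow> (\<exists>p. pre_digraph.awalk G u p v \<and> length p \<le> l)"

lemma walk_within_mono: "walk_within G u v k \<Longrightarrow> k \<le> l \<Longrightarrow> walk_within G u v l"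
  unfolding walk_within_def by (meson order_trans)

context wf_digraph
begin

lemma walk_within_refl: "u \<in> verts G \<Longrightarrow> walk_within G u u l"
  unfolding walk_within_def by (intro exI[of _ "[]"]) (simp add: awalk_Nil_iff)

lemma walk_within_arc: "e \<in> arcs G \<Longrightarrow> 1 \<le> l \<Longrightarrow> walk_within G (tail G e) (head G e) l"
  unfolding walk_within_def using arc_implies_awalk[of e] by (intro exI[of _ "[e]"]) simp

lemma walk_within_trans:
  assumes "walk_within G u v k" "walk_within G v w l" "k + l \<le> m"
  shows "walk_within G u w m"
proof -
  from assms(1,2) obtain p q where "awalk u p v" "length p \<le> k" "awalk v q w" "length q \<le> l"
    unfolding walk_within_def by blast
  with assms(3) show ?thesis
    unfolding walk_within_def by (intro exI[of _ "p @ q"]) (auto intro: awalk_appendI)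
qed

lemma walk_within_reachable: "walk_within G u v l \<Longrightarrow> u \<rightarrow>\<^sup>* v"
  unfolding walk_within_def reachable_awalk by blast

lemma walk_within_distance_le: "walk_within G u v l \<Longrightarrow> distance G u v \<le> l"
proof -
  assume "walk_within G u v l"
  then obtain p where "awalk u p v" "length p \<le> l" unfolding walk_within_def by blast
  then have "distance G u v \<le> length p" unfolding distance_def by (intro cInf_lower) auto
  with \<open>length p \<le> l\<close> show ?thesis by simp
qed

lemma diameter_le:
  assumes "verts G \<noteq> {}" and "\<And>u v. u \<in> verts G \<Longrightarrow> v \<in> verts G \<Longrightarrow> walk_within G u v l"
  shows "diameter G \<le> l"
proof -
  let ?S = "{distance G s t | s t. s \<rightarrow>\<^sup>* t}"
  have le: "\<forall>d \<in> ?S. d \<le> l"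
    using assms(2) by (auto intro!: walk_within_distance_le dest: reachable_in_verts)
  moreover have "finite ?S" using le by (meson finite_nat_set_iff_bounded_le)
  moreover have "?S \<noteq> {}" using assms(1) by auto
  ultimately show ?thesis unfolding diameter_def by simp
qed

end

section \<open>Short walks in the dyadic graph\<close>

context
  fixes n :: nat
begin

interpretation D: digraph "dyadic_digraph n" by (rule digraph_dyadic)

lemma walk_within_refl_dyadic: "v < n \<Longrightarrow> walk_within (dyadic_digraph n) v v l"
  by (rule D.walk_within_refl) (simp add: dyadic_digraph_def)

lemma walk_within_dyadic_step:
  assumes "2 ^ k dvd a" "a + 2 ^ k < n"
  shows "walk_within (dyadic_digraph n) a (a + 2 ^ k) 1"
proof -
  have "(a, a + 2 ^ k) \<in> arcs (dyadic_digraph n)"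
    using assms by (auto simp: dyadic_digraph_def dyadic_steps_def)
  from D.walk_within_arc[OF this, of 1] show ?thesis by (simp add: dyadic_digraph_def)
qed

text \<open>Binary search: each halving of the block costs at most one arc, from its left end to its
  midpoint.\<close>

lemma walk_within_from_left_end:
  assumes "2 ^ k dvd a" "a \<le> v" "v < a + 2 ^ k" "v < n"
  shows "walk_within (dyadic_digraph n) a v k"
  using assms
proof (induction k arbitrary: a)
  case 0
  then have "a = v" by simp
  with 0 show ?case by (simp add: walk_within_refl_dyadic)
next
  case (Suc k)
  have a: "2 ^ k dvd a" using Suc.prems(1) by (rule power_le_dvd) simp
  show ?case
  proof (cases "v < a + 2 ^ k")
    case True
    then have "walk_within (dyadic_digraph n) a v k" using Suc a by simp
    then show ?thesis by (rule walk_within_mono) simp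
  next
    case False
    then have "walk_within (dyadic_digraph n) (a + 2 ^ k) v k" using Suc a by simp
    moreover have "walk_within (dyadic_digraph n) a (a + 2 ^ k) 1"
      using a False Suc.prems by (intro walk_within_dyadic_step) auto
    ultimately show ?thesis by (auto intro: D.walk_within_trans)
  qed
qed

text \<open>The mirror image, climbing to the right end. The block is now open on the left, so that
  for \<open>k = 0\<close> the walk is empty.\<close>

lemma walk_within_to_right_end:
  assumes "2 ^ k dvd a" "a < u" "u \<le> a + 2 ^ k" "a + 2 ^ k < n"
  shows "walk_within (dyadic_digraph n) u (a + 2 ^ k) k"
  using assms
proof (induction k arbitrary: a)
  case 0
  then have "u = a + 1" by simp
  with 0 show ?case by (simp add: walk_within_refl_dyadic)
next
  case (Suc k)
  have a: "2 ^ k dvd a" using Suc.prems(1) by (rule power_le_dvd) simp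
  show ?case
  proof (cases "u \<le> a + 2 ^ k")
    case True
    then have "walk_within (dyadic_digraph n) u (a + 2 ^ k) k" using Suc a by simp
    moreover have "walk_within (dyadic_digraph n) (a + 2 ^ k) (a + 2 ^ k + 2 ^ k) 1"
      using a Suc.prems by (intro walk_within_dyadic_step) auto
    ultimately show ?thesis by (auto intro: D.walk_within_trans simp: mult_2 add.assoc)
  next
    case False
    then have "walk_within (dyadic_digraph n) u (a + 2 ^ k + 2 ^ k) k"
      using Suc.prems a by (intro Suc.IH) auto
    then have "walk_within (dyadic_digraph n) u (a + 2 ^ k + 2 ^ k) (Suc k)"
      by (rule walk_within_mono) simp
    then show ?thesis by (simp add: mult_2 add.assoc)
  qed
qed

text \<open>Halve the block until its midpoint separates \<open>u\<close> from \<open>v\<close>,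
  then climb from \<open>u\<close> to the midpoint and descend to \<open>v\<close>. The case
  \<open>u = a\<close> is separate because the climb excludes the left end.\<close>

lemma walk_within_forward:
  assumes "2 ^ k dvd a" "a \<le> u" "u \<le> v" "v < a + 2 ^ k" "v < n"
  shows "walk_within (dyadic_digraph n) u v (2 * k)"
  using assms
proof (induction k arbitrary: a)
  case 0
  then have "u = v" by simp
  with 0 show ?case by (simp add: walk_within_refl_dyadic)
next
  case (Suc k)
  have a: "2 ^ k dvd a" using Suc.prems(1) by (rule power_le_dvd) simp
  consider "v < a + 2 ^ k" | "a + 2 ^ k \<le> u" | "u = a" | "a < u" "u < a + 2 ^ k" "a + 2 ^ k \<le> v"
    using Suc.prems by linarith
  then show ?case
  proof cases
    case 1
    then have "walk_within (dyadic_digraph n) u v (2 * k)" using Suc a by simp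
    then show ?thesis by (rule walk_within_mono) simp
  next
    case 2
    then have "walk_within (dyadic_digraph n) u v (2 * k)"
      using Suc.prems a by (intro Suc.IH[of "a + 2 ^ k"]) auto
    then show ?thesis by (rule walk_within_mono) simp
  next
    case 3
    then have "walk_within (dyadic_digraph n) u v (Suc k)"
      using Suc.prems by (intro walk_within_from_left_end) auto
    then show ?thesis by (rule walk_within_mono) simp
  next
    case 4
    then have "walk_within (dyadic_digraph n) u (a + 2 ^ k) k"
      using Suc.prems a by (intro walk_within_to_right_end) auto
    moreover have "walk_within (dyadic_digraph n) (a + 2 ^ k) v k"
      using 4 Suc.prems a by (intro walk_within_from_left_end) auto
    ultimately show ?thesis by (rule D.walk_within_trans) simp
  qed
qed

lemma walk_within_dyadic:
  assumes "u < n" "v < n" "n \<le> 2 ^ k"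
  shows "walk_within (dyadic_digraph n) u v (4 * k + 1)"
proof (cases "u \<le> v")
  case True
  then have "walk_within (dyadic_digraph n) u v (2 * k)"
    \<comment> \<open>The block of length \<open>2 ^ k\<close> starting at 0 contains every
      vertex.\<close>
    using assms by (intro walk_within_forward[of k 0]) auto
  then show ?thesis by (rule walk_within_mono) simp
next
  case False
  have "(n - 1, 0) \<in> arcs (dyadic_digraph n)"
    using False assms(1) by (auto simp: dyadic_digraph_def)
  from D.walk_within_arc[OF this, of 1]
  have "walk_within (dyadic_digraph n) (n - 1) 0 1" by (simp add: dyadic_digraph_def)
  moreover have "walk_within (dyadic_digraph n) u (n - 1) (2 * k)"
    using assms by (intro walk_within_forward[of k 0]) auto
  ultimately have "walk_within (dyadic_digraph n) u 0 (2 * k + 1)"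
    by (auto intro: D.walk_within_trans)
  moreover have "walk_within (dyadic_digraph n) 0 v (2 * k)"
    using assms by (intro walk_within_forward[of k 0]) auto
  ultimately show ?thesis by (rule D.walk_within_trans) simp
qed

lemma dyadic_reachable: "u < n \<Longrightarrow> v < n \<Longrightarrow> u \<rightarrow>\<^sup>*\<^bsub>dyadic_digraph n\<^esub> v"
  \<comment> \<open>The crude exponent \<open>n\<close> is enough here, as
    \<open>n < 2 ^ n\<close>.\<close>
  using walk_within_dyadic[of u v n] by (auto intro: D.walk_within_reachable less_imp_le)

lemma diameter_dyadic_le:
  assumes "0 < n" "n \<le> 2 ^ k"
  shows "diameter (dyadic_digraph n) \<le> 4 * k + 1"
  using assms by (intro D.diameter_le walk_within_dyadic) (auto simp: dyadic_digraph_def)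

end

text \<open>With \<open>k\<close> \<le> \<open>log 2 n + 1\<close> the bound
  \<open>4 * k + 1\<close> is at most \<open>4 * log 2 n + 5\<close>, hence at most
  \<open>9 * log 2 n\<close> once \<open>n\<close> \<ge> 2.\<close>

lemma diameter_dyadic_bigo: "(\<lambda>n. real (diameter (dyadic_digraph n))) \<in> O(\<lambda>n. ln (real n))"
proof (rule bigoI)
  show "\<forall>\<^sub>F n in sequentially.
    norm (real (diameter (dyadic_digraph n))) \<le> (9 / ln 2) * norm (ln (real n))"
    using eventually_ge_at_top[of 2]
  proof eventually_elim
    case (elim n)
    define k where "k = nat \<lceil>log 2 (real n)\<rceil>"
    have log1: "1 \<le> log 2 (real n)" using elim by (simp add: le_log_iff)
    have k: "log 2 (real n) \<le> real k" "real k \<le> log 2 (real n) + 1"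
      using log1 unfolding k_def by linarith+
    have "real n \<le> 2 powr real k" using k(1) elim by (simp add: log_le_iff)
    then have "real n \<le> real (2 ^ k)" by (simp add: powr_realpow)
    then have "n \<le> 2 ^ k" by (simp only: of_nat_le_iff)
    with elim have "diameter (dyadic_digraph n) \<le> 4 * k + 1" by (intro diameter_dyadic_le) auto
    then have "real (diameter (dyadic_digraph n)) \<le> 9 * log 2 (real n)"
      using k(2) log1 by linarith
    then show ?case using elim by (simp add: log_def)
  qed
qed

theorem theorem6:
  shows "\<exists>G :: nat \<Rightarrow> (nat, nat \<times> nat) pre_digraph.
    (\<forall>n \<ge> 1. digraph (G n) \<and> card (verts (G n)) = n) \<and>
    (\<lambda>n. real (diameter (G n))) \<in> O(\<lambda>n. ln (real n)) \<and>
    (\<forall>n \<ge> 1. \<forall>Ds. dag_cover_no_additional_edges (G n) Ds \<longrightarrow>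
       reachability_preserving (G n) Ds \<longrightarrow> n \<le> length Ds)"
proof (intro exI[of _ dyadic_digraph] conjI allI impI)
  fix n :: nat and Ds
  assume "1 \<le> n" and cover: "dag_cover_no_additional_edges (dyadic_digraph n) Ds"
    and pres: "reachability_preserving (dyadic_digraph n) Ds"
  \<comment> \<open>The dyadic graph is strongly connected, so every hard pair must be
    served.\<close>
  have "\<exists>D \<in> set Ds. i \<rightarrow>\<^sup>*\<^bsub>D\<^esub> cyclic_pred (n - 1) i" if "i < n" for i
  proof -
    have "cyclic_pred (n - 1) i < n" using that by (auto simp: cyclic_pred_def)
    with that pres dyadic_reachable[of i n "cyclic_pred (n - 1) i"] show ?thesis
      by (auto simp: reachability_preserving_def dyadic_digraph_def)
  qed
  then obtain f where f: "f i \<in> set Ds" "i \<rightarrow>\<^sup>*\<^bsub>f i\<^esub> cyclic_pred (n - 1) i" if "i < n" for i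
    by metis
  have "inj_on f {..<n}"
  proof (rule linorder_inj_onI)
    fix i j assume "i < j" "i \<in> {..<n}" "j \<in> {..<n}"
    then show "f i \<noteq> f j"
      using f[of i] f[of j] cover dyadic_cover_conflict[of "f j" n i j]
      by (auto simp: dag_cover_no_additional_edges_def)
  qed auto
  moreover have "f ` {..<n} \<subseteq> set Ds" using f(1) by auto
  \<comment> \<open>Repetitions in the list only increase its length, so counting distinct members
    suffices.\<close>
  ultimately have "card {..<n} \<le> card (set Ds)" by (intro card_inj_on_le) auto
  with card_length[of Ds] show "n \<le> length Ds" by simp
qed (simp_all add: digraph_dyadic diameter_dyadic_bigo card_verts_dyadic)

end
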